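(* Suppose $G$ is a finite, connected digital group. Then $G$ is simple digitally contractible.
   Context: A tolerance space is a set $X$ with a symmetric, reflexive relation $\sim$ (adjacency); it is identified with the simple graph whose edges join distinct adjacent points, and it is connected if this graph is connected. A digital group is a tolerance space $G$ with a group structure such that multiplication is continuous, in the sense that $a\sim b$ and $c\sim d$ imply $a\cdot c\sim b\cdot d$, and inversion is continuous, i.e. $a\sim b$ implies $a^{-1}\sim b^{-1}$. For a vertex $v$ of a graph $G$, the link $\mathrm{lk}_G(v)$ is the induced subgraph on the neighbors of $v$ (excluding $v$). The simple digitally contractible finite tolerance spaces form the smallest class (closed under isomorphism) containing the one-point space and closed under the following simple contractible transformations: deleting a simple vertex (a vertex $v$ whose link is simple digitally contractible) together with its incident edges; attaching a new vertex with incident edges so that it is simple; deleting a simple edge $uw$ (an edge for which the induced subgraph on $\mathrm{lk}_G(u)\cap\mathrm{lk}_G(w)$ is simple digitally contractible); attaching an edge between two non-adjacent vertices so that it is simple. The empty space is not simple digitally contractible. *)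

theory Defs
  imports "HOL-Algebra.Group"
begin

locale tolerance_space =
  fixes X :: "'a set" and R :: "'a rel"
  assumes adj_subset: "R \<subseteq> X \<times> X"
    and adj_refl: "x \<in> X \<Longrightarrow> (x, x) \<in> R"
    and adj_sym: "(x, y) \<in> R \<Longrightarrow> (y, x) \<in> R"

text \<open>\<open>R - Id\<close> is the edge relation of the associated simple graph.\<close>

definition connected_space :: "'a set \<Rightarrow> 'a rel \<Rightarrow> bool" where
  "connected_space X R \<longleftrightarrow> (\<forall>x\<in>X. \<forall>y\<in>X. (x, y) \<in> (R - Id)\<^sup>*)"

definition isomorphic_spaces :: "'a set \<Rightarrow> 'a rel \<Rightarrow> 'b set \<Rightarrow> 'b rel \<Rightarrow> bool" where
  "isomorphic_spaces X R Y S \<longleftrightarrow>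
     (\<exists>f. bij_betw f X Y \<and> (\<forall>x\<in>X. \<forall>y\<in>X. (x, y) \<in> R \<longleftrightarrow> (f x, f y) \<in> S))"

definition link :: "'a rel \<Rightarrow> 'a \<Rightarrow> 'a set" where
  "link R v = {x. x \<noteq> v \<and> (v, x) \<in> R}"

definition add_vertex :: "'a rel \<Rightarrow> 'a \<Rightarrow> 'a set \<Rightarrow> 'a rel" where
  "add_vertex R v N = R \<union> {(v, v)} \<union> {v} \<times> N \<union> N \<times> {v}"

definition add_edge :: "'a rel \<Rightarrow> 'a \<Rightarrow> 'a \<Rightarrow> 'a rel" where
  "add_edge R u w = R \<union> {(u, w), (w, u)}"

definition del_edge :: "'a rel \<Rightarrow> 'a \<Rightarrow> 'a \<Rightarrow> 'a rel" where
  "del_edge R u w = R - {(u, w), (w, u)}"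

text \<open>
  The smallest class, for spaces with points in \<open>nat\<close>. An infinite type of points is needed:
  otherwise a new vertex could not always be attached. \<open>Restr R A\<close> is the induced subspace on \<open>A\<close>.
  When a vertex or an edge is attached, its simplicity is tested in the enlarged space.
\<close>

inductive sdc_nat :: "nat set \<Rightarrow> nat rel \<Rightarrow> bool" where
  point: "sdc_nat {x} {(x, x)}"
| iso: "sdc_nat X R \<Longrightarrow> tolerance_space Y S \<Longrightarrow> isomorphic_spaces X R Y S \<Longrightarrow> sdc_nat Y S"
| delete_vertex:
    "sdc_nat X R \<Longrightarrow> v \<in> X \<Longrightarrow> sdc_nat (link R v) (Restr R (link R v))
      \<Longrightarrow> sdc_nat (X - {v}) (Restr R (X - {v}))"
| attach_vertex:
    "sdc_nat X R \<Longrightarrow> v \<notin> X \<Longrightarrow> N \<subseteq> X \<Longrightarrow> R' = add_vertex R v N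
      \<Longrightarrow> sdc_nat (link R' v) (Restr R' (link R' v))
      \<Longrightarrow> sdc_nat (insert v X) R'"
| delete_edge:
    "sdc_nat X R \<Longrightarrow> u \<noteq> w \<Longrightarrow> (u, w) \<in> R
      \<Longrightarrow> sdc_nat (link R u \<inter> link R w) (Restr R (link R u \<inter> link R w))
      \<Longrightarrow> sdc_nat X (del_edge R u w)"
| attach_edge:
    "sdc_nat X R \<Longrightarrow> u \<in> X \<Longrightarrow> w \<in> X \<Longrightarrow> u \<noteq> w \<Longrightarrow> (u, w) \<notin> R \<Longrightarrow> R' = add_edge R u w
      \<Longrightarrow> sdc_nat (link R' u \<inter> link R' w) (Restr R' (link R' u \<inter> link R' w))
      \<Longrightarrow> sdc_nat X R'"

lemma sdc_nat_space: "sdc_nat X R \<Longrightarrow> finite X \<and> X \<noteq> {} \<and> tolerance_space X R"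
proof (induction rule: sdc_nat.induct)
  case (point x)
  show ?case by (simp add: tolerance_space_def)
next
  case (iso X R Y S)
  from \<open>isomorphic_spaces X R Y S\<close> obtain f where "bij_betw f X Y"
    unfolding isomorphic_spaces_def by blast
  then have "Y = f ` X"
    by (simp add: bij_betw_imp_surj_on)
  with iso show ?case by simp
next
  case (delete_vertex X R v)
  then interpret tolerance_space X R by blast
  have "link R v \<subseteq> X - {v}"
    using adj_subset by (auto simp: link_def)
  then have "X - {v} \<noteq> {}"
    using delete_vertex.IH(2) by blast
  moreover have "tolerance_space (X - {v}) (Restr R (X - {v}))"
    by unfold_locales (auto intro: adj_refl adj_sym)
  ultimately show ?case
    using delete_vertex.IH(1) by simp
next
  case (attach_vertex X R v N R')
  then interpret tolerance_space X R by blast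
  have "tolerance_space (insert v X) (add_vertex R v N)"
    unfolding add_vertex_def
    using adj_subset \<open>N \<subseteq> X\<close> by unfold_locales (auto intro: adj_refl adj_sym)
  with attach_vertex.IH(1) attach_vertex.hyps show ?case by simp
next
  case (delete_edge X R u w)
  then interpret tolerance_space X R by blast
  have "tolerance_space X (del_edge R u w)"
    unfolding del_edge_def
    using adj_subset \<open>u \<noteq> w\<close> by unfold_locales (auto intro: adj_refl adj_sym)
  with delete_edge.IH(1) show ?case by simp
next
  case (attach_edge X R u w R')
  then interpret tolerance_space X R by blast
  have "tolerance_space X (add_edge R u w)"
    unfolding add_edge_def
    using adj_subset \<open>u \<in> X\<close> \<open>w \<in> X\<close> by unfold_locales (auto intro: adj_refl adj_sym)
  with attach_edge.IH(1) attach_edge.hyps show ?case by simp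
qed

text \<open>
  A finite space over an arbitrary type of points always has an isomorphic copy in \<open>nat\<close>.
\<close>

definition simple_digitally_contractible :: "'a set \<Rightarrow> 'a rel \<Rightarrow> bool" where
  "simple_digitally_contractible X R \<longleftrightarrow>
     tolerance_space X R \<and> (\<exists>Y S. sdc_nat Y S \<and> isomorphic_spaces Y S X R)"

locale digital_group = group G + tolerance_space "carrier G" R
  for G (structure) and R +
  assumes mult_continuous: "(a, b) \<in> R \<Longrightarrow> (c, d) \<in> R \<Longrightarrow> (a \<otimes> c, b \<otimes> d) \<in> R"
    and inv_continuous: "(a, b) \<in> R \<Longrightarrow> (inv a, inv b) \<in> R"

end

theory Submission imports Defs begin

text \<open>
  A digital group carries the Mal'cev operation \<open>(x, y, z) \<mapsto> x y\<^sup>-\<^sup>1 z\<close>, which satisfies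
  \<open>x y\<^sup>-\<^sup>1 y = x\<close> and \<open>y y\<^sup>-\<^sup>1 z = z\<close>. Continuity of the multiplication makes this operation
  preserve adjacency, and a reflexive relation preserved by a Mal'cev operation is transitive.
  So adjacency in a digital group is an equivalence relation, and its classes are the connected
  components (they are the cosets of the normal subgroup formed by the points adjacent to the
  identity). If the group is connected, any two points are therefore adjacent: the space is a
  complete graph.

  A finite nonempty complete graph is built from a point by attaching one vertex at a time to
  all earlier ones. Each new vertex is simple, since its link is the complete graph built so far.
\<close>

text \<open>
  If \<open>a \<sim> b \<sim> c\<close>, multiply the adjacent pairs \<open>(a, b)\<close>, \<open>(b\<^sup>-\<^sup>1, b\<^sup>-\<^sup>1)\<close> and \<open>(b, c)\<close>: the
  first components cancel to \<open>a\<close>, the second ones to \<open>c\<close>.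
\<close>

lemma (in digital_group) adj_trans: "trans R"
proof (rule transI)
  fix a b c
  assume ab: "(a, b) \<in> R" and bc: "(b, c) \<in> R"
  then have carr: "a \<in> carrier G" "b \<in> carrier G" "c \<in> carrier G"
    using adj_subset by auto
  have "(a \<otimes> inv b, b \<otimes> inv b) \<in> R"
    using carr by (intro mult_continuous[OF ab] adj_refl inv_closed)
  from mult_continuous[OF this bc] show "(a, c) \<in> R"
    using carr by (simp add: m_assoc)
qed

lemma (in digital_group) connected_imp_complete:
  assumes "connected_space (carrier G) R"
  shows "R = carrier G \<times> carrier G"
proof
  show "carrier G \<times> carrier G \<subseteq> R"
  proof (rule subrelI)
    fix x y
    assume "(x, y) \<in> carrier G \<times> carrier G"
    then have "x \<in> carrier G" and "(x, y) \<in> (R - Id)\<^sup>*"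
      using assms by (auto simp: connected_space_def)
    from this(2) show "(x, y) \<in> R"
      by induction (use \<open>x \<in> carrier G\<close> adj_refl adj_trans in \<open>auto dest: transD\<close>)
  qed
qed (rule adj_subset)

lemma sdc_nat_complete:
  assumes "finite X" and "X \<noteq> {}"
  shows "sdc_nat X (X \<times> X)"
  using assms
proof (induction rule: finite_ne_induct)
  case (singleton x)
  then show ?case using sdc_nat.point[of x] by simp
next
  case (insert v X)
  let ?R' = "add_vertex (X \<times> X) v X"
  have complete: "?R' = insert v X \<times> insert v X"
    by (auto simp: add_vertex_def)
  then have "link ?R' v = X"
    using \<open>v \<notin> X\<close> by (auto simp: link_def)
  moreover have "Restr ?R' X = X \<times> X"
    unfolding complete by blast
  ultimately have "sdc_nat (link ?R' v) (Restr ?R' (link ?R' v))"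
    using insert.IH by simp
  from sdc_nat.attach_vertex[OF insert.IH \<open>v \<notin> X\<close> subset_refl refl this]
  show ?case by (simp add: complete)
qed

lemma complete_space_contractible:
  assumes "finite X" and "X \<noteq> {}"
  shows "simple_digitally_contractible X (X \<times> X)"
proof -
  obtain f where f: "bij_betw f {0..<card X} X"
    using ex_bij_betw_nat_finite[OF \<open>finite X\<close>] by blast
  let ?Y = "{0..<card X}"
  have "sdc_nat ?Y (?Y \<times> ?Y)"
    using assms by (intro sdc_nat_complete) (simp_all add: card_gt_0_iff)
  moreover have "isomorphic_spaces ?Y (?Y \<times> ?Y) X (X \<times> X)"
    unfolding isomorphic_spaces_def using f bij_betwE[OF f] by blast
  moreover have "tolerance_space X (X \<times> X)"
    by unfold_locales auto
  ultimately show ?thesis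
    unfolding simple_digitally_contractible_def by blast
qed

theorem theorem3p13:
  fixes G :: "('a, 'b) monoid_scheme" and R :: "'a rel"
  assumes "digital_group G R"
    and "finite (carrier G)"
    and "connected_space (carrier G) R"
  shows "simple_digitally_contractible (carrier G) R"
proof -
  interpret digital_group G R by (rule assms(1))
  have "R = carrier G \<times> carrier G"
    using assms(3) by (rule connected_imp_complete)
  then show ?thesis
    using complete_space_contractible[OF assms(2) carrier_not_empty] by simp
qed

end
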